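(* Let $STS(n)$ denote the number of Steiner triple systems on the vertex set $[n]=\{1,\dots,n\}$. Then, as $n\to\infty$, $$ STS(n) \leq \left( (1 + o(1)) \frac{n}{e^2} \right)^{\frac{n^2}{6}} ;$$ that is, there is a function $\varepsilon(n)\to 0$ as $n\to\infty$ such that $STS(n) \le \left((1+\varepsilon(n))\frac{n}{e^2}\right)^{n^2/6}$ for every $n$.
   Context: A Steiner triple system on a vertex set $V$ is a collection $T\subseteq\binom{V}{3}$ of 3-element subsets (triples) such that every pair of distinct vertices of $V$ is contained in exactly one triple of $T$. Such systems exist (for $n\ge 1$) if and only if $n\equiv 1$ or $3 \pmod 6$; for other $n$, $STS(n)=0$. Here $e$ is the base of the natural logarithm. *)

theory Defs
  imports Complex_Main
begin

definition steiner_triple_system :: "'a set \<Rightarrow> 'a set set \<Rightarrow> bool" where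
  "steiner_triple_system V T \<longleftrightarrow>
     T \<subseteq> {S. S \<subseteq> V \<and> card S = 3} \<and>
     (\<forall>x\<in>V. \<forall>y\<in>V. x \<noteq> y \<longrightarrow> (\<exists>!S. S \<in> T \<and> {x, y} \<subseteq> S))"

definition STS :: "nat \<Rightarrow> nat" where
  "STS n = card {T. steiner_triple_system {1..n} T}"

lemma finite_steiner_triple_systems:
  "finite V \<Longrightarrow> finite {T. steiner_triple_system V T}"
  by (rule finite_subset [of _ "Pow (Pow V)"]) (auto simp: steiner_triple_system_def)

end

theory Submission
  imports Defs "HOL-Library.FuncSet" "HOL-Real_Asymp.Real_Asymp"
begin

text \<open>
  Entropy argument. Give every pair \<open>e\<close> of points a label in \<open>{0,\<dots>,m-1}\<close> and reveal the blocks of a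
  uniformly random system \<open>T\<close> pair by pair, in increasing order of the labels. The block of \<open>e\<close> is
  already known unless \<open>e\<close> has the smallest label in it; otherwise a wrong third point \<open>k\<close> is still
  possible only if the six pairs in the two blocks joining \<open>k\<close> to the ends of \<open>e\<close> have labels at
  least that of \<open>e\<close>. For uniformly random labels, if \<open>x\<close> is the proportion of labels at least that
  of \<open>e\<close>, these events have probabilities about \<open>x\<^sup>2\<close> and \<open>x\<^sup>6\<close>, and they are independent because
  distinct blocks share no pair. By the chain rule and Jensen's inequality, \<open>ln (STS n)\<close> is at most
  about \<open>n\<^sup>2/2\<close> times the integral of \<open>x\<^sup>2 ln (1 + n x\<^sup>6)\<close> over \<open>[0,1]\<close>, which is
  \<open>(ln n - 2)/3 + o(1)\<close>. Discrete labels keep everything finite; \<open>m \<approx> n\<^bsup>1/5\<^esup>\<close> makes both the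
  discretisation error \<open>ln n / m\<close> and the error \<open>m\<^sup>4 / n\<close> from dropping the \<open>1 +\<close> tend to zero.
\<close>

section \<open>Logarithmic inequalities\<close>

text \<open>Jensen's inequality for \<open>ln\<close>: the tangent at the mean lies above
  \<open>ln\<close>, and its linear terms sum to zero.\<close>

lemma sum_ln_le_card_ln_mean:
  fixes g :: "'a \<Rightarrow> real"
  assumes "finite A" and pos: "\<And>x. x \<in> A \<Longrightarrow> g x > 0"
  shows "(\<Sum>x\<in>A. ln (g x)) \<le> real (card A) * ln (sum g A / real (card A))"
proof (cases "A = {}")
  case False
  define \<mu> where "\<mu> = sum g A / real (card A)"
  have card: "real (card A) > 0"
    using assms False by (simp add: card_gt_0_iff)
  have "sum g A > 0"
    using assms False by (simp add: sum_pos)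
  then have \<mu>: "\<mu> > 0"
    using card by (simp add: \<mu>_def)
  have "(\<Sum>x\<in>A. ln (g x)) \<le> (\<Sum>x\<in>A. ln \<mu> + (g x / \<mu> - 1))"
  proof (rule sum_mono)
    fix x assume "x \<in> A"
    then have "ln (g x / \<mu>) \<le> g x / \<mu> - 1"
      using pos \<mu> by (intro ln_le_minus_one) simp
    then show "ln (g x) \<le> ln \<mu> + (g x / \<mu> - 1)"
      using pos[OF \<open>x \<in> A\<close>] \<mu> by (simp add: ln_div)
  qed
  also have "\<dots> = real (card A) * ln \<mu> + (sum g A / \<mu> - real (card A))"
    by (simp add: sum.distrib sum_subtractf sum_divide_distrib)
  also have "sum g A / \<mu> = real (card A)"
    using \<open>sum g A > 0\<close> card by (simp add: \<mu>_def)
  finally show ?thesis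
    by (simp add: \<mu>_def)
qed simp

text \<open>Entropy of a uniform element of \<open>A\<close>, scaled by \<open>card A\<close>: the
  value of \<open>f\<close> carries at most the logarithm of the number of values, and the rest is
  the entropy left inside the fibres.\<close>

lemma card_ln_card_le_fibres:
  fixes f :: "'a \<Rightarrow> 'b"
  assumes "finite A"
  shows "real (card A) * ln (real (card A)) \<le> real (card A) * ln (real (card (f ` A)))
    + (\<Sum>b\<in>f ` A. real (card {x \<in> A. f x = b}) * ln (real (card {x \<in> A. f x = b})))"
proof (cases "A = {}")
  case False
  define N where "N b = real (card {x \<in> A. f x = b})" for b
  define a where "a = real (card A)"
  define k where "k = real (card (f ` A))"
  have pos: "a > 0" "k > 0"
    using assms False by (simp_all add: a_def k_def card_gt_0_iff)
  have N: "N b > 0" if "b \<in> f ` A" for b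
    using assms that by (auto simp: N_def card_gt_0_iff)
  have sumN: "(\<Sum>b\<in>f ` A. N b) = a"
    using sum.image_gen[OF assms, of "\<lambda>_. 1::real" f] by (simp add: a_def N_def)
  have "a * ln a - a * ln k - (\<Sum>b\<in>f ` A. N b * ln (N b))
      = (\<Sum>b\<in>f ` A. N b) * (ln a - ln k) - (\<Sum>b\<in>f ` A. N b * ln (N b))"
    by (simp add: sumN algebra_simps)
  also have "\<dots> = (\<Sum>b\<in>f ` A. N b * (ln a - ln k - ln (N b)))"
    unfolding sum_distrib_right sum_subtractf[symmetric]
    by (intro sum.cong refl) (simp add: algebra_simps)
  \<comment> \<open>Gibbs' inequality against the uniform distribution on the image: the
    \<open>k\<close> terms \<open>a / k\<close> and the fibre sizes both sum to
    \<open>a\<close>.\<close>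
  also have "\<dots> \<le> (\<Sum>b\<in>f ` A. a / k - N b)"
  proof (rule sum_mono)
    fix b assume "b \<in> f ` A"
    note Nb = N[OF this]
    have "ln (a / (k * N b)) \<le> a / (k * N b) - 1"
      using pos Nb by (intro ln_le_minus_one) simp
    then have "N b * ln (a / (k * N b)) \<le> N b * (a / (k * N b) - 1)"
      using Nb by (simp add: mult_left_mono)
    also have "\<dots> = a / k - N b"
      using pos Nb by (simp add: field_simps)
    finally show "N b * (ln a - ln k - ln (N b)) \<le> a / k - N b"
      using pos Nb by (simp add: ln_div ln_mult algebra_simps)
  qed
  also have "\<dots> = 0"
    using pos by (simp add: sum_subtractf sumN) (simp add: k_def)
  finally show ?thesis
    by (simp add: N_def a_def k_def)
qed simp

text \<open>The chain rule for the entropy of a uniformly random element \<open>x\<close> of \<open>A\<close>: the queries \<open>q\<close>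
  are answered one after the other by \<open>f q x\<close>, and \<open>c q x\<close> bounds the number of answers to \<open>q\<close>
  that are compatible with the earlier ones.\<close>

lemma card_ln_card_le_chain:
  fixes f :: "'q \<Rightarrow> 'a \<Rightarrow> 'b" and c :: "'q \<Rightarrow> 'a \<Rightarrow> real"
  assumes "finite A" and "distinct qs"
    and inj: "\<And>x y. x \<in> A \<Longrightarrow> y \<in> A \<Longrightarrow> \<forall>q\<in>set qs. f q x = f q y \<Longrightarrow> x = y"
    and bound: "\<And>ps q rs x. qs = ps @ q # rs \<Longrightarrow> x \<in> A \<Longrightarrow>
      real (card (f q ` {y \<in> A. \<forall>p\<in>set ps. f p y = f p x})) \<le> c q x"
  shows "real (card A) * ln (real (card A)) \<le> (\<Sum>x\<in>A. \<Sum>q\<in>set qs. ln (c q x))"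
  using assms
proof (induction qs arbitrary: A)
  case Nil
  \<comment> \<open>With no queries left, \<open>inj\<close> identifies all elements of
    \<open>A\<close>, so both sides vanish.\<close>
  have "card A \<le> 1"
    using Nil.prems(1,3) by (simp add: card_le_Suc0_iff_eq)
  then have "card A = 0 \<or> card A = 1"
    by linarith
  then show ?case
    by auto
next
  case (Cons q qs)
  \<comment> \<open>Once \<open>q\<close> is answered, only a fibre remains. A history
    \<open>ps\<close> inside it is the history \<open>q # ps\<close> in \<open>A\<close>, so the
    same bounds \<open>c\<close> serve.\<close>
  define F where "F b = {x \<in> A. f q x = b}" for b
  have fibre: "real (card (F b)) * ln (real (card (F b))) \<le> (\<Sum>x\<in>F b. \<Sum>p\<in>set qs. ln (c p x))"
    for b
  proof (rule Cons.IH)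
    show "finite (F b)" "distinct qs"
      using Cons.prems(1,2) by (simp_all add: F_def)
    show "x = y" if "x \<in> F b" "y \<in> F b" "\<forall>p\<in>set qs. f p x = f p y" for x y
      using that Cons.prems(3)[of x y] by (simp add: F_def)
    show "real (card (f p ` {y \<in> F b. \<forall>r\<in>set ps. f r y = f r x})) \<le> c p x"
      if "qs = ps @ p # rs" "x \<in> F b" for ps p rs x
    proof -
      have "{y \<in> F b. \<forall>r\<in>set ps. f r y = f r x} = {y \<in> A. \<forall>r\<in>set (q # ps). f r y = f r x}"
        using that(2) by (auto simp: F_def)
      then show ?thesis
        using Cons.prems(4)[of "q # ps" p rs x] that by (simp add: F_def)
    qed
  qed
  have first: "ln (real (card (f q ` A))) \<le> ln (c q x)" if "x \<in> A" for x
  proof -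
    have "real (card (f q ` A)) \<le> c q x"
      using Cons.prems(4)[of "[]" q qs x] that by simp
    moreover have "real (card (f q ` A)) > 0"
      using that Cons.prems(1) by (auto simp: card_gt_0_iff)
    ultimately show ?thesis
      by simp
  qed
  have "real (card A) * ln (real (card A)) \<le> real (card A) * ln (real (card (f q ` A)))
    + (\<Sum>b\<in>f q ` A. real (card (F b)) * ln (real (card (F b))))"
    unfolding F_def by (rule card_ln_card_le_fibres) fact
  also have "\<dots> \<le> (\<Sum>x\<in>A. ln (c q x)) + (\<Sum>b\<in>f q ` A. \<Sum>x\<in>F b. \<Sum>p\<in>set qs. ln (c p x))"
    using sum_mono[of A "\<lambda>_. ln (real (card (f q ` A)))", OF first] fibre
    by (intro add_mono sum_mono) auto
  also have "(\<Sum>b\<in>f q ` A. \<Sum>x\<in>F b. \<Sum>p\<in>set qs. ln (c p x)) = (\<Sum>x\<in>A. \<Sum>p\<in>set qs. ln (c p x))"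
    unfolding F_def by (rule sum.image_gen[symmetric]) fact
  also have "(\<Sum>x\<in>A. ln (c q x)) + \<dots> = (\<Sum>x\<in>A. \<Sum>p\<in>set (q # qs). ln (c p x))"
    using Cons.prems(2) by (simp add: sum.distrib)
  finally show ?case .
qed

section \<open>Pairs and blocks\<close>

definition pairs :: "'a set \<Rightarrow> 'a set set" where
  "pairs S = {p. p \<subseteq> S \<and> card p = 2}"

definition block :: "'a set set \<Rightarrow> 'a set \<Rightarrow> 'a set" where
  "block T e = (THE S. S \<in> T \<and> e \<subseteq> S)"

lemma finite_pairs: "finite S \<Longrightarrow> finite (pairs S)"
  by (simp add: pairs_def)

lemma card_pairs: "finite S \<Longrightarrow> card (pairs S) = card S choose 2"
  by (simp add: pairs_def n_subsets)

lemma pairs_mono: "S \<subseteq> S' \<Longrightarrow> pairs S \<subseteq> pairs S'"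
  by (auto simp: pairs_def)

lemma doubleton_in_pairs: "i \<in> S \<Longrightarrow> k \<in> S \<Longrightarrow> i \<noteq> k \<Longrightarrow> {i, k} \<in> pairs S"
  by (simp add: pairs_def)

context
  fixes V :: "'a set" and T :: "'a set set"
  assumes sts: "steiner_triple_system V T"
begin

lemma block_ex1: "e \<in> pairs V \<Longrightarrow> \<exists>!S. S \<in> T \<and> e \<subseteq> S"
proof -
  assume "e \<in> pairs V"
  then obtain x y where "e = {x, y}" "x \<noteq> y" "x \<in> V" "y \<in> V"
    by (auto simp: pairs_def card_2_iff)
  then show ?thesis
    using sts[unfolded steiner_triple_system_def, THEN conjunct2, rule_format, of x y] by simp
qed

lemma block_in: "e \<in> pairs V \<Longrightarrow> block T e \<in> T"
  and subset_block: "e \<in> pairs V \<Longrightarrow> e \<subseteq> block T e"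
  unfolding block_def using theI'[OF block_ex1, of e] by simp_all

lemma block_eqI: "e \<in> pairs V \<Longrightarrow> S \<in> T \<Longrightarrow> e \<subseteq> S \<Longrightarrow> block T e = S"
  unfolding block_def by (rule the1_equality[OF block_ex1]) simp_all

lemma triple_subset: "S \<in> T \<Longrightarrow> S \<subseteq> V"
  and card_triple: "S \<in> T \<Longrightarrow> card S = 3"
  using sts[unfolded steiner_triple_system_def, THEN conjunct1] by auto

lemma finite_triple: "S \<in> T \<Longrightarrow> finite S"
  using card_triple[of S] by (intro card_ge_0_finite) simp

lemma card_pairs_triple: "S \<in> T \<Longrightarrow> card (pairs S) = 3"
  using card_pairs[OF finite_triple, of S] card_triple[of S] by (simp add: choose_two)

lemma finite_pairs_triple: "S \<in> T \<Longrightarrow> finite (pairs S)"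
  by (intro finite_pairs finite_triple)

text \<open>A common pair would lie in two triples. This disjointness later makes the label
  conditions on different blocks independent.\<close>

lemma pairs_triple_disjoint:
  assumes "S \<in> T" "S' \<in> T" "S \<noteq> S'"
  shows "pairs S \<inter> pairs S' = {}"
proof (rule ccontr)
  assume "pairs S \<inter> pairs S' \<noteq> {}"
  then obtain p where "p \<in> pairs S" "p \<in> pairs S'"
    by blast
  then have "p \<in> pairs V" "p \<subseteq> S" "p \<subseteq> S'"
    using triple_subset[OF assms(1)] by (auto simp: pairs_def)
  then show False
    using block_eqI assms by metis
qed

end

text \<open>Every triple is the block of any pair inside it. Hence the answers to all block queries
  determine the system, as the chain rule requires.\<close>

lemma steiner_triple_system_block_image:
  assumes "steiner_triple_system V T"
  shows "T = block T ` pairs V"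
proof
  show "block T ` pairs V \<subseteq> T"
    using block_in[OF assms] by auto
  show "T \<subseteq> block T ` pairs V"
  proof
    fix S assume S: "S \<in> T"
    then have "pairs S \<noteq> {}"
      using card_pairs_triple[OF assms S] by auto
    then obtain p where "p \<in> pairs S"
      by blast
    then have "p \<in> pairs V" "p \<subseteq> S"
      using triple_subset[OF assms S] by (auto simp: pairs_def)
    then show "S \<in> block T ` pairs V"
      using block_eqI[OF assms _ S] by (intro image_eqI[of _ _ p]) auto
  qed
qed

section \<open>Counting the available blocks\<close>

text \<open>The points \<open>k\<close>, other than the third point of the true block, for which \<open>e \<union> {k}\<close> cannot be
  excluded as the block of \<open>e\<close> once the blocks of all pairs with label below \<open>L e\<close> are known.\<close>

definition rivals :: "'a set \<Rightarrow> 'a set set \<Rightarrow> ('a set \<Rightarrow> nat) \<Rightarrow> 'a set \<Rightarrow> 'a set" where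
  "rivals V T L e = {k \<in> V - block T e. \<forall>i\<in>e. \<forall>p\<in>pairs (block T {i, k}). L e \<le> L p}"

definition avail :: "'a set \<Rightarrow> 'a set set \<Rightarrow> ('a set \<Rightarrow> nat) \<Rightarrow> 'a set \<Rightarrow> real" where
  "avail V T L e = (if \<forall>p\<in>pairs (block T e). L e \<le> L p then 1 + real (card (rivals V T L e)) else 1)"

text \<open>A pair with a smaller label passes its whole block on from \<open>T\<close> to every
  \<open>T'\<close>. If that block is the block of \<open>e\<close>, the answer is forced; otherwise
  such blocks exclude third points, and the rivals are those not excluded.\<close>

lemma card_block_image_le_avail:
  assumes "finite V" and T: "steiner_triple_system V T" and e: "e \<in> pairs V"
    and \<A>: "\<And>T'. T' \<in> \<A> \<Longrightarrow> steiner_triple_system V T'"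
    and agree: "\<And>T' p. T' \<in> \<A> \<Longrightarrow> p \<in> pairs V \<Longrightarrow> L p < L e \<Longrightarrow> block T' p = block T p"
  shows "real (card ((\<lambda>T'. block T' e) ` \<A>)) \<le> avail V T L e"
proof (cases "\<forall>p\<in>pairs (block T e). L e \<le> L p")
  case False
  then obtain p where p: "p \<in> pairs (block T e)" "L p < L e"
    by (auto simp: not_le)
  have pV: "p \<in> pairs V" "p \<subseteq> block T e"
    using p triple_subset[OF T block_in[OF T e]] by (auto simp: pairs_def)
  have "block T' e = block T e" if T': "T' \<in> \<A>" for T'
  proof -
    have "block T' p = block T e"
      using agree[OF T' pV(1) p(2)] block_eqI[OF T pV(1) block_in[OF T e] pV(2)] by simp
    then have "block T e \<in> T'"
      using block_in[OF \<A>[OF T'] pV(1)] by simp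
    then show ?thesis
      using block_eqI[OF \<A>[OF T'] e] subset_block[OF T e] by simp
  qed
  then have "(\<lambda>T'. block T' e) ` \<A> \<subseteq> {block T e}"
    by auto
  then have "card ((\<lambda>T'. block T' e) ` \<A>) \<le> card {block T e}"
    by (intro card_mono) auto
  then show ?thesis
    using False by (simp add: avail_def)
next
  case True
  have fin: "finite (rivals V T L e)"
    using assms(1) by (simp add: rivals_def)
  have "block T' e \<in> insert (block T e) ((\<lambda>k. insert k e) ` rivals V T L e)" if T': "T' \<in> \<A>" for T'
  proof (cases "block T' e = block T e")
    case False
    define S where "S = block T' e"
    have S: "S \<in> T'" "e \<subseteq> S" "card S = 3" "S \<subseteq> V"
      using block_in[OF \<A>[OF T'] e] subset_block[OF \<A>[OF T'] e]
        card_triple[OF \<A>[OF T']] triple_subset[OF \<A>[OF T']] by (auto simp: S_def)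
    have "card e = 2" "finite e"
      using e by (auto simp: pairs_def intro: card_ge_0_finite)
    then have "card (S - e) = 1"
      using S by (simp add: card_Diff_subset)
    then obtain k where "S - e = {k}"
      by (auto simp: card_1_singleton_iff)
    then have k: "S = insert k e" "k \<notin> e"
      using S(2) by auto
    have kT: "k \<notin> block T e"
    proof
      assume "k \<in> block T e"
      then have "S \<subseteq> block T e"
        using subset_block[OF T e] k by auto
      moreover have "card (block T e) = 3"
        using card_triple[OF T block_in[OF T e]] .
      ultimately show False
        using S(3) False card_subset_eq[of "block T e" S] by (simp add: S_def card_ge_0_finite)
    qed
    have "L e \<le> L p" if i: "i \<in> e" and p: "p \<in> pairs (block T {i, k})" for i p
    proof (rule ccontr)
      assume "\<not> L e \<le> L p"
      then have less: "L p < L e"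
        by simp
      define R where "R = block T {i, k}"
      have ik: "{i, k} \<in> pairs V"
        using i k S(4) by (intro doubleton_in_pairs) auto
      have R: "R \<in> T" "{i, k} \<subseteq> R"
        using block_in[OF T ik] subset_block[OF T ik] by (simp_all add: R_def)
      have pV: "p \<in> pairs V" "p \<subseteq> R"
        using p triple_subset[OF T R(1)] by (auto simp: pairs_def R_def)
      have "block T' p = R"
        using agree[OF T' pV(1) less] block_eqI[OF T pV(1) R(1) pV(2)] by simp
      then have "R \<in> T'"
        using block_in[OF \<A>[OF T'] pV(1)] by simp
      \<comment> \<open>\<open>R\<close> and \<open>S\<close> are triples of \<open>T'\<close>
        through \<open>{i, k}\<close>, so they coincide. Then \<open>R\<close> contains
        \<open>e\<close>, which puts \<open>k\<close> into the block of \<open>e\<close> in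
        \<open>T\<close>.\<close>
      then have "R = S"
        using block_eqI[OF \<A>[OF T'] ik] R(2) S(1) i k by (metis empty_subsetI insertCI insert_subset)
      then have "block T e = R"
        using block_eqI[OF T e R(1)] S(2) by simp
      then show False
        using kT R(2) by simp
    qed
    then have "k \<in> rivals V T L e"
      using kT k S(4) by (auto simp: rivals_def)
    then show ?thesis
      using k by (auto simp: S_def)
  qed simp
  then have "(\<lambda>T'. block T' e) ` \<A> \<subseteq> insert (block T e) ((\<lambda>k. insert k e) ` rivals V T L e)"
    by blast
  then have "card ((\<lambda>T'. block T' e) ` \<A>) \<le> card (insert (block T e) ((\<lambda>k. insert k e) ` rivals V T L e))"
    using fin by (intro card_mono) auto
  also have "\<dots> \<le> Suc (card ((\<lambda>k. insert k e) ` rivals V T L e))"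
    by (rule card_insert_le_m1) (auto)
  also have "\<dots> \<le> Suc (card (rivals V T L e))"
    using card_image_le[OF fin] by simp
  finally show ?thesis
    using True by (simp add: avail_def)
qed

lemma card_ln_card_le_avail:
  fixes V :: "'a set" and L :: "'a set \<Rightarrow> nat"
  assumes V: "finite V"
  defines "\<A> \<equiv> {T. steiner_triple_system V T}"
  shows "real (card \<A>) * ln (real (card \<A>)) \<le> (\<Sum>T\<in>\<A>. \<Sum>e\<in>pairs V. ln (avail V T L e))"
proof -
  obtain es0 where es0: "set es0 = pairs V" "distinct es0"
    using finite_distinct_list[OF finite_pairs[OF V]] by blast
  define es where "es = sort_key L es0"
  have es: "set es = pairs V" "distinct es" "sorted (map L es)"
    using es0 by (simp_all add: es_def)
  have "real (card \<A>) * ln (real (card \<A>)) \<le> (\<Sum>T\<in>\<A>. \<Sum>e\<in>set es. ln (avail V T L e))"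
  proof (rule card_ln_card_le_chain[where f = "\<lambda>e T. block T e"])
    show "finite \<A>"
      using finite_steiner_triple_systems[OF V] by (simp add: \<A>_def)
    show "distinct es"
      by fact
    show "T = T'" if "T \<in> \<A>" "T' \<in> \<A>" "\<forall>e\<in>set es. block T e = block T' e" for T T'
    proof -
      have "block T ` pairs V = block T' ` pairs V"
        using that(3) es(1) by (intro image_cong) auto
      then show ?thesis
        using that(1,2) steiner_triple_system_block_image[of V T]
          steiner_triple_system_block_image[of V T'] by (simp add: \<A>_def)
    qed
    show "real (card ((\<lambda>T. block T e) ` {T' \<in> \<A>. \<forall>p\<in>set ps. block T' p = block T p})) \<le> avail V T L e"
      if split: "es = ps @ e # rs" and "T \<in> \<A>" for ps e rs T
    proof (rule card_block_image_le_avail[OF V])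
      show "steiner_triple_system V T" "e \<in> pairs V"
        using that es(1) by (auto simp: \<A>_def)
      fix T' assume T': "T' \<in> {T' \<in> \<A>. \<forall>p\<in>set ps. block T' p = block T p}"
      then show "steiner_triple_system V T'"
        by (simp add: \<A>_def)
      fix p assume "p \<in> pairs V" "L p < L e"
      \<comment> \<open>Pairs with equal labels may stand in either order; only strictly smaller
        labels surely come earlier, and \<open>avail\<close> relies on nothing else.\<close>
      then have "p \<in> set ps"
        using es(1,3) unfolding split by (force simp: sorted_append)
      then show "block T' p = block T p"
        using T' by simp
    qed
  qed
  then show ?thesis
    by (simp add: es(1))
qed

section \<open>Averaging over the labellings\<close>

text \<open>The label of \<open>e\<close> is forced, each pair in \<open>P\<close> keeps
  \<open>m - s\<close> of its \<open>m\<close> choices, and all other pairs are free.\<close>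

lemma card_labellings_ge:
  assumes "finite E" "e \<in> E" "P \<subseteq> E" "e \<notin> P" "s < m"
  shows "real (card {L \<in> E \<rightarrow>\<^sub>E {..<m}. L e = s \<and> (\<forall>p\<in>P. s \<le> L p)})
    = real m ^ card E / real m * (real (m - s) / real m) ^ card P"
proof -
  define x where "x = real (m - s) / real m"
  define B where "B p = (if p = e then {s} else if p \<in> P then {s..<m} else {..<m})" for p
  \<comment> \<open>The factors \<open>card (B p)\<close> divided by \<open>m\<close>: only
    \<open>e\<close> and the elements of \<open>P\<close> contribute something other than 1.\<close>
  define g where "g p = (if p = e then 1 / real m else if p \<in> P then x else 1)" for p
  have "{L \<in> E \<rightarrow>\<^sub>E {..<m}. L e = s \<and> (\<forall>p\<in>P. s \<le> L p)} = PiE E B"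
  proof (intro set_eqI iffI)
    fix L assume "L \<in> {L \<in> E \<rightarrow>\<^sub>E {..<m}. L e = s \<and> (\<forall>p\<in>P. s \<le> L p)}"
    then show "L \<in> PiE E B"
      by (auto simp: B_def PiE_iff)
  next
    fix L assume L: "L \<in> PiE E B"
    then have B: "L p \<in> B p" if "p \<in> E" for p
      using that by (auto simp: PiE_iff)
    have "L p < m" if "p \<in> E" for p
      using B[OF that] assms(5) by (auto simp: B_def split: if_splits)
    moreover have "L e = s"
      using B[OF assms(2)] by (simp add: B_def)
    moreover have "s \<le> L p" if "p \<in> P" for p
      using B[of p] that assms(3,4) by (auto simp: B_def split: if_splits)
    ultimately show "L \<in> {L \<in> E \<rightarrow>\<^sub>E {..<m}. L e = s \<and> (\<forall>p\<in>P. s \<le> L p)}"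
      using L by (auto simp: PiE_iff)
  qed
  then have "real (card {L \<in> E \<rightarrow>\<^sub>E {..<m}. L e = s \<and> (\<forall>p\<in>P. s \<le> L p)}) = (\<Prod>p\<in>E. real (card (B p)))"
    using assms(1) by (simp add: card_PiE)
  also have "\<dots> = (\<Prod>p\<in>E. real m * g p)"
    using assms(5) by (intro prod.cong) (auto simp: B_def g_def x_def)
  also have "\<dots> = real m ^ card E * (\<Prod>p\<in>E. g p)"
    by (simp add: prod.distrib)
  also have "(\<Prod>p\<in>E. g p) = g e * (\<Prod>p\<in>E - {e}. g p)"
    using assms(1,2) by (rule prod.remove)
  also have "(\<Prod>p\<in>E - {e}. g p) = (\<Prod>p\<in>P. x)"
    using assms by (intro prod.mono_neutral_cong_right) (auto simp: g_def)
  finally show ?thesis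
    by (simp add: g_def x_def)
qed

text \<open>Group the labellings by the label \<open>s\<close> of \<open>e\<close>, and apply Jensen
  only where \<open>e\<close> has the smallest label of its block. The probability
  \<open>x\<^sup>2\<close> of that event then stays outside the logarithm, and inside it each rival
  costs the conditional probability \<open>x ^ 6\<close>.\<close>

lemma sum_ln_avail_le:
  fixes V :: "'a set"
  assumes V: "finite V" and T: "steiner_triple_system V T" and e: "e \<in> pairs V"
  shows "(\<Sum>L\<in>pairs V \<rightarrow>\<^sub>E {..<m}. ln (avail V T L e)) \<le>
    real m ^ card (pairs V) / real m *
      (\<Sum>s<m. (real (m - s) / real m)\<^sup>2 * ln (1 + real (card V) * (real (m - s) / real m) ^ 6))"
proof -
  define E where "E = pairs V"
  define \<Omega> where "\<Omega> = E \<rightarrow>\<^sub>E {..<m}"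
  define S where "S = block T e"
  \<comment> \<open>\<open>P\<close> decides whether the block of \<open>e\<close> is still unknown,
    \<open>Q k\<close> whether \<open>k\<close> is a rival. \<open>M\<close> is the number of
    labellings with a prescribed label at \<open>e\<close>.\<close>
  define P where "P = pairs S - {e}"
  define Q where "Q k = (\<Union>i\<in>e. pairs (block T {i, k}))" for k
  define M where "M = real m ^ card E / real m"
  have E: "finite E" "e \<in> E"
    using V e by (auto simp: E_def finite_pairs)
  have \<Omega>: "finite \<Omega>"
    using E by (simp add: \<Omega>_def finite_PiE)
  have S: "S \<in> T" "e \<subseteq> S" "S \<subseteq> V"
    using block_in[OF T e] subset_block[OF T e] triple_subset[OF T] by (auto simp: S_def)
  have eS: "e \<in> pairs S"
    using e S by (simp add: pairs_def)
  have P: "P \<subseteq> E" "e \<notin> P" "finite P" "card P = 2"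
    using pairs_mono[OF S(3)] finite_pairs_triple[OF T S(1)] card_pairs_triple[OF T S(1)] eS
    by (auto simp: P_def E_def)
  \<comment> \<open>The true block and the two blocks joining \<open>k\<close> to the ends of
    \<open>e\<close> are three distinct triples, hence share no pair: 2 + 3 + 3 = 8.\<close>
  have Q: "Q k \<subseteq> E" "e \<notin> Q k" "card (P \<union> Q k) = 8" if k: "k \<in> V - S" for k
  proof -
    obtain i j where ij: "e = {i, j}" "i \<noteq> j"
      using e by (auto simp: pairs_def card_2_iff)
    define R where "R l = block T {l, k}" for l
    have lk: "{l, k} \<in> pairs V" if "l \<in> e" for l
      using that k S by (intro doubleton_in_pairs) auto
    have R: "R l \<in> T" "l \<in> R l" "k \<in> R l" if "l \<in> e" for l
      using block_in[OF T lk[OF that]] subset_block[OF T lk[OF that]] by (auto simp: R_def)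
    have RS: "R l \<noteq> S" if "l \<in> e" for l
      using R(3)[OF that] k by auto
    have Rij: "R i \<noteq> R j"
    proof
      assume "R i = R j"
      then have "e \<subseteq> R i"
        using R(2)[of i] R(2)[of j] ij by auto
      then have "R i = S"
        using block_eqI[OF T e, of "R i"] R(1)[of i] ij by (simp add: S_def)
      then show False
        using RS[of i] ij by simp
    qed
    have Q_eq: "Q k = pairs (R i) \<union> pairs (R j)"
      by (simp add: Q_def R_def ij(1))
    note RT = R(1)[of i] R(1)[of j]
    have dis: "pairs (R i) \<inter> pairs (R j) = {}" "pairs S \<inter> pairs (R i) = {}" "pairs S \<inter> pairs (R j) = {}"
      using RT RS[of i] RS[of j] Rij S(1) ij(1) pairs_triple_disjoint[OF T] by auto
    show "Q k \<subseteq> E"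
      using RT triple_subset[OF T] pairs_mono ij(1) unfolding Q_eq E_def by (metis Un_least insertCI)
    show "e \<notin> Q k"
      using dis eS unfolding Q_eq by auto
    have "card (Q k) = 6"
      using RT dis(1) ij(1) unfolding Q_eq
      by (simp add: card_Un_disjoint card_pairs_triple[OF T] finite_pairs_triple[OF T])
    moreover have "P \<inter> Q k = {}"
      using dis(2,3) unfolding Q_eq P_def by auto
    moreover have "finite (Q k)"
      using RT ij(1) unfolding Q_eq by (simp add: finite_pairs_triple[OF T])
    ultimately show "card (P \<union> Q k) = 8"
      using P(3,4) by (simp add: card_Un_disjoint)
  qed
  have level: "(\<Sum>L\<in>{L \<in> \<Omega>. L e = s}. ln (avail V T L e))
      \<le> M * (x\<^sup>2 * ln (1 + real (card V) * x ^ 6))" if "s < m" and x: "x = real (m - s) / real m" for s x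
  proof -
    define \<Omega>s where "\<Omega>s = {L \<in> \<Omega>. L e = s \<and> (\<forall>p\<in>P. s \<le> L p)}"
    have fin: "finite \<Omega>s"
      using \<Omega> by (simp add: \<Omega>s_def)
    have x0: "x > 0" and M0: "M > 0"
      using that by (simp_all add: M_def)
    have card\<Omega>s: "real (card \<Omega>s) = M * x\<^sup>2"
      using card_labellings_ge[OF E P(1,2) \<open>s < m\<close>] by (simp add: \<Omega>s_def \<Omega>_def M_def x P(4))
    then have card0: "real (card \<Omega>s) > 0"
      using M0 x0 by simp
    have iff: "(\<forall>p\<in>pairs (block T e). L e \<le> L p) \<longleftrightarrow> (\<forall>p\<in>P. L e \<le> L p)" for L :: "'a set \<Rightarrow> nat"
      by (auto simp: P_def S_def)
    have "(\<Sum>L\<in>{L \<in> \<Omega>. L e = s}. ln (avail V T L e)) = (\<Sum>L\<in>\<Omega>s. ln (1 + real (card (rivals V T L e))))"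
    proof (rule sum.mono_neutral_cong_right)
      \<comment> \<open>Where the block is already known, \<open>avail\<close> is 1 and its
        logarithm vanishes.\<close>
      show "\<forall>L\<in>{L \<in> \<Omega>. L e = s} - \<Omega>s. ln (avail V T L e) = 0"
        unfolding avail_def iff by (auto simp: \<Omega>s_def)
      show "ln (avail V T L e) = ln (1 + real (card (rivals V T L e)))" if "L \<in> \<Omega>s" for L
        using that unfolding avail_def iff by (auto simp: \<Omega>s_def)
    qed (use \<Omega> in \<open>auto simp: \<Omega>s_def\<close>)
    also have "\<dots> \<le> real (card \<Omega>s) * ln ((\<Sum>L\<in>\<Omega>s. 1 + real (card (rivals V T L e))) / real (card \<Omega>s))"
      using fin by (intro sum_ln_le_card_ln_mean) auto
    also have "\<dots> \<le> real (card \<Omega>s) * ln (1 + real (card V) * x ^ 6)"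
    proof -
      have "(\<Sum>L\<in>\<Omega>s. real (card (rivals V T L e)))
          = (\<Sum>L\<in>\<Omega>s. \<Sum>k\<in>V - S. if \<forall>p\<in>Q k. s \<le> L p then 1 else 0)"
      proof (rule sum.cong)
        fix L assume "L \<in> \<Omega>s"
        then have "rivals V T L e = {k \<in> V - S. \<forall>p\<in>Q k. s \<le> L p}"
          by (auto simp: rivals_def \<Omega>s_def S_def Q_def)
        then show "real (card (rivals V T L e)) = (\<Sum>k\<in>V - S. if \<forall>p\<in>Q k. s \<le> L p then 1 else 0)"
          using V by (simp add: sum.If_cases Int_def)
      qed simp
      also have "\<dots> = (\<Sum>k\<in>V - S. \<Sum>L\<in>\<Omega>s. if \<forall>p\<in>Q k. s \<le> L p then 1 else 0)"
        by (rule sum.swap)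
      also have "\<dots> = (\<Sum>k\<in>V - S. M * x ^ 8)"
      proof (rule sum.cong)
        fix k assume k: "k \<in> V - S"
        have "(\<Sum>L\<in>\<Omega>s. if \<forall>p\<in>Q k. s \<le> L p then 1 else 0) = real (card {L \<in> \<Omega>s. \<forall>p\<in>Q k. s \<le> L p})"
          using fin by (simp add: sum.If_cases Int_def)
        also have "{L \<in> \<Omega>s. \<forall>p\<in>Q k. s \<le> L p} = {L \<in> E \<rightarrow>\<^sub>E {..<m}. L e = s \<and> (\<forall>p\<in>P \<union> Q k. s \<le> L p)}"
          by (auto simp: \<Omega>s_def \<Omega>_def)
        also have "real (card \<dots>) = M * x ^ 8"
          using card_labellings_ge[OF E, of "P \<union> Q k" s m] P(1,2) Q[OF k] \<open>s < m\<close>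
          by (simp add: M_def x)
        finally show "(\<Sum>L\<in>\<Omega>s. if \<forall>p\<in>Q k. s \<le> L p then 1 else 0) = M * x ^ 8" .
      qed simp
      also have "\<dots> \<le> real (card V) * (M * x ^ 8)"
        using V M0 x0 by (simp add: card_mono mult_right_mono)
      finally have "(\<Sum>L\<in>\<Omega>s. 1 + real (card (rivals V T L e))) \<le> real (card \<Omega>s) + real (card V) * (M * x ^ 8)"
        by (simp add: sum.distrib)
      \<comment> \<open>Dividing the joint count \<open>M * x ^ 8\<close> by
        \<open>card \<Omega>s = M * x\<^sup>2\<close> leaves the conditional probability
        \<open>x ^ 6\<close>.\<close>
      also have "\<dots> = real (card \<Omega>s) * (1 + real (card V) * x ^ 6)"
        by (simp add: card\<Omega>s algebra_simps flip: power_add)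
      finally have "(\<Sum>L\<in>\<Omega>s. 1 + real (card (rivals V T L e))) / real (card \<Omega>s) \<le> 1 + real (card V) * x ^ 6"
        using card0 by (simp add: field_simps)
      moreover have "(\<Sum>L\<in>\<Omega>s. 1 + real (card (rivals V T L e))) > 0"
        using fin card0 by (intro sum_pos) auto
      ultimately show ?thesis
        using card0 by (intro mult_left_mono ln_mono divide_pos_pos) auto
    qed
    finally show ?thesis
      by (simp add: card\<Omega>s)
  qed
  have "(\<Sum>L\<in>\<Omega>. ln (avail V T L e)) = (\<Sum>s<m. \<Sum>L\<in>{L \<in> \<Omega>. L e = s}. ln (avail V T L e))"
    using \<Omega> E(2) by (intro sum.group[symmetric]) (auto simp: \<Omega>_def)
  also have "\<dots> \<le> (\<Sum>s<m. M * ((real (m - s) / real m)\<^sup>2 * ln (1 + real (card V) * (real (m - s) / real m) ^ 6)))"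
    using level by (intro sum_mono) auto
  finally show ?thesis
    by (simp add: \<Omega>_def E_def M_def sum_distrib_left)
qed

text \<open>The chain-rule bound holds for every labelling, so it may be summed over all of them.
  The bound per pair depends on neither the system nor the pair, so the number of systems
  cancels.\<close>

lemma ln_card_steiner_triple_systems_le:
  assumes V: "finite V" and m: "m > 0"
  shows "ln (real (card {T. steiner_triple_system V T})) \<le> real (card V choose 2) / real m *
    (\<Sum>u=1..m. (real u / real m)\<^sup>2 * ln (1 + real (card V) * (real u / real m) ^ 6))"
proof -
  define \<A> where "\<A> = {T. steiner_triple_system V T}"
  define \<Omega> where "\<Omega> = pairs V \<rightarrow>\<^sub>E {..<m}"
  define N where "N = card (pairs V)"
  define h where "h u = (real u / real m)\<^sup>2 * ln (1 + real (card V) * (real u / real m) ^ 6)" for u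
  have fin: "finite \<A>"
    using finite_steiner_triple_systems[OF V] by (simp add: \<A>_def)
  have h0: "h u \<ge> 0" for u
    by (simp add: h_def)
  \<comment> \<open>\<open>u = m - s\<close> is the number of labels that are at least
    \<open>s\<close>.\<close>
  have sum_h: "(\<Sum>s<m. h (m - s)) = (\<Sum>u=1..m. h u)"
    by (rule sum.reindex_bij_witness[where i = "\<lambda>u. m - u" and j = "\<lambda>s. m - s"]) auto
  show ?thesis
  proof (cases "\<A> = {}")
    \<comment> \<open>Without any system the left side is \<open>ln 0\<close>, which is 0 by
      convention.\<close>
    case True
    have "(\<Sum>u=1..m. h u) \<ge> 0"
      by (intro sum_nonneg h0)
    then show ?thesis
      using True by (simp add: \<A>_def h_def)
  next
    case False
    have a: "real (card \<A>) > 0"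
      using fin False by (simp add: card_gt_0_iff)
    have card\<Omega>: "real (card \<Omega>) = real m ^ N"
      using finite_pairs[OF V] by (simp add: \<Omega>_def N_def card_PiE)
    have "real m ^ N * (real (card \<A>) * ln (real (card \<A>))) = (\<Sum>L\<in>\<Omega>. real (card \<A>) * ln (real (card \<A>)))"
      by (simp add: card\<Omega>)
    also have "\<dots> \<le> (\<Sum>L\<in>\<Omega>. \<Sum>T\<in>\<A>. \<Sum>e\<in>pairs V. ln (avail V T L e))"
      unfolding \<A>_def by (intro sum_mono card_ln_card_le_avail V)
    also have "\<dots> = (\<Sum>T\<in>\<A>. \<Sum>L\<in>\<Omega>. \<Sum>e\<in>pairs V. ln (avail V T L e))"
      by (rule sum.swap)
    also have "\<dots> = (\<Sum>T\<in>\<A>. \<Sum>e\<in>pairs V. \<Sum>L\<in>\<Omega>. ln (avail V T L e))"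
      by (intro sum.cong refl sum.swap)
    also have "\<dots> \<le> (\<Sum>T\<in>\<A>. \<Sum>e\<in>pairs V. real m ^ N / real m * (\<Sum>s<m. h (m - s)))"
      unfolding \<Omega>_def N_def h_def by (intro sum_mono sum_ln_avail_le V) (auto simp: \<A>_def)
    also have "\<dots> = (real m ^ N * real (card \<A>)) * (real N / real m * (\<Sum>u=1..m. h u))"
      by (simp add: sum_h N_def)
    finally have "ln (real (card \<A>)) \<le> real N / real m * (\<Sum>u=1..m. h u)"
      using a m by (simp only: mult.assoc mult_le_cancel_left_pos zero_less_power of_nat_0_less_iff)
    then show ?thesis
      using card_pairs[OF V] by (simp add: \<A>_def h_def N_def)
  qed
qed

section \<open>Asymptotics\<close>

lemma sum_squares_upto: "(\<Sum>u=1..m. (real u)\<^sup>2) = real m * (real m + 1) * (2 * real m + 1) / 6"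
  by (induction m) (simp_all add: field_simps power2_eq_square)

text \<open>A discrete form of \<open>\<integral>\<^sub>0\<^sup>1 x\<^sup>2 ln x dx = - 1/9\<close>.\<close>

lemma sum_squares_ln_le:
  assumes "m > 0"
  shows "(\<Sum>u=1..m. (real u)\<^sup>2 * ln (real u / real m)) \<le> (real m)\<^sup>2 - real m ^ 3 / 9"
proof -
  define p where "p m = real m * (real m + 1) * (2 * real m + 1) / 6" for m
  have main: "(\<Sum>u=1..m. (real u)\<^sup>2 * ln (real u)) \<le> p m * ln (real m) + (real m)\<^sup>2 - real m ^ 3 / 9"
    using assms
  proof (induction m rule: nat_induct_non_zero)
    case (Suc m)
    define r where "r = real m"
    have r: "r > 0"
      using Suc.hyps by (simp add: r_def)
    have pS: "p (Suc m) = p m + (r + 1)\<^sup>2" and pm: "p m = r * (r + 1) * (2 * r + 1) / 6"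
      by (simp_all add: p_def r_def field_simps power2_eq_square)
    have "ln (r / (r + 1)) \<le> r / (r + 1) - 1"
      using r by (intro ln_le_minus_one) simp
    then have "ln r - ln (r + 1) \<le> - (1 / (r + 1))"
      using r by (simp add: ln_div field_simps)
    \<comment> \<open>Passing from \<open>ln r\<close> to \<open>ln (r + 1)\<close> gains at least
      \<open>p m / (r + 1)\<close>, and \<open>p m\<close> has the factor
      \<open>r + 1\<close>.\<close>
    then have "p m * (ln r - ln (r + 1)) \<le> p m * (- (1 / (r + 1)))"
      using r by (intro mult_left_mono) (auto simp: pm)
    also have "\<dots> = - (r * (2 * r + 1) / 6)"
      using r by (simp add: pm field_simps)
    finally have *: "p m * ln r \<le> p m * ln (r + 1) - r * (2 * r + 1) / 6"
      by (simp add: algebra_simps)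
    have "(\<Sum>u=1..Suc m. (real u)\<^sup>2 * ln (real u))
        \<le> p m * ln r + r\<^sup>2 - r ^ 3 / 9 + (r + 1)\<^sup>2 * ln (r + 1)"
      using Suc.IH by (simp add: r_def add.commute)
    also have "\<dots> \<le> (p m + (r + 1)\<^sup>2) * ln (r + 1) - r * (2 * r + 1) / 6 + r\<^sup>2 - r ^ 3 / 9"
      using * by (simp add: algebra_simps)
    \<comment> \<open>The quadratic terms cancel thanks to the constant 1/9; the slack
      \<open>11 * r / 6 + 8 / 9\<close> is positive.\<close>
    also have "\<dots> \<le> p (Suc m) * ln (r + 1) + (r + 1)\<^sup>2 - (r + 1) ^ 3 / 9"
      using r by (simp add: pS field_simps power2_eq_square power3_eq_cube)
    finally show ?case
      by (simp add: r_def add.commute)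
  qed (simp add: p_def)
  have "(\<Sum>u=1..m. (real u)\<^sup>2 * ln (real u / real m))
      = (\<Sum>u=1..m. (real u)\<^sup>2 * ln (real u)) - (\<Sum>u=1..m. (real u)\<^sup>2) * ln (real m)"
    unfolding sum_distrib_right sum_subtractf[symmetric]
    using assms by (intro sum.cong refl) (auto simp: ln_div algebra_simps)
  then show ?thesis
    using main unfolding sum_squares_upto p_def by simp
qed

text \<open>With \<open>y = n * x ^ 6\<close>, use \<open>ln (1 + y) \<le> ln y + 1 / y\<close>. The
  main terms are \<open>ln n / 3\<close> and \<open>6 * (- 1/9) = - 2/3\<close>; the discretisation
  errors have order \<open>1 / m\<close>.\<close>

lemma mean_squares_ln_le:
  assumes m: "m > 0" and n: "n > 0"
  shows "(\<Sum>u=1..m. (real u / real m)\<^sup>2 * ln (1 + real n * (real u / real m) ^ 6)) / real m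
    \<le> (ln (real n) - 2) / 3 + (ln (real n) + 6) / real m + real m ^ 4 / real n"
proof -
  have "(\<Sum>u=1..m. (real u / real m)\<^sup>2 * ln (1 + real n * (real u / real m) ^ 6))
     \<le> (\<Sum>u=1..m. ((real u)\<^sup>2 * ln (real n) + 6 * ((real u)\<^sup>2 * ln (real u / real m))) / (real m)\<^sup>2
          + real m ^ 4 / real n)"
  proof (rule sum_mono)
    fix u assume "u \<in> {1..m}"
    then have u: "real u \<ge> 1"
      by simp
    define x where "x = real u / real m"
    have x: "x > 0"
      using u m by (simp add: x_def)
    define y where "y = real n * x ^ 6"
    have y: "y > 0"
      using x n by (simp add: y_def)
    have "ln (1 + y) = ln y + ln (1 + 1 / y)"
    proof -
      have "1 + y = y * (1 + 1 / y)"
        using y by (simp add: field_simps)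
      moreover have "ln (y * (1 + 1 / y)) = ln y + ln (1 + 1 / y)"
        using y by (intro ln_mult_pos add_pos_pos) auto
      ultimately show ?thesis
        by metis
    qed
    also have "\<dots> \<le> ln y + 1 / y"
      using y by (simp add: ln_add_one_self_le_self)
    also have "ln y = ln (real n) + 6 * ln x"
      using x n by (simp add: y_def ln_mult ln_realpow)
    finally have "x\<^sup>2 * ln (1 + y) \<le> x\<^sup>2 * (ln (real n) + 6 * ln x + 1 / y)"
      by (simp add: mult_left_mono)
    also have "\<dots> = x\<^sup>2 * ln (real n) + 6 * (x\<^sup>2 * ln x) + x\<^sup>2 / y"
      by (simp add: algebra_simps)
    also have "x\<^sup>2 / y = real m ^ 4 / (real n * real u ^ 4)"
      using u m n by (simp add: y_def x_def field_simps flip: power_add)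
    \<comment> \<open>The smallest grid point \<open>x = 1 / m\<close> is the worst case for
      \<open>1 / (n * x ^ 4)\<close>.\<close>
    also have "\<dots> \<le> real m ^ 4 / (real n * 1)"
      using u n by (intro divide_left_mono mult_left_mono) auto
    finally show "(real u / real m)\<^sup>2 * ln (1 + real n * (real u / real m) ^ 6)
        \<le> ((real u)\<^sup>2 * ln (real n) + 6 * ((real u)\<^sup>2 * ln (real u / real m))) / (real m)\<^sup>2
          + real m ^ 4 / real n"
      by (simp add: y_def x_def power_divide add_divide_distrib)
  qed
  also have "\<dots> = ((\<Sum>u=1..m. (real u)\<^sup>2) * ln (real n)
      + 6 * (\<Sum>u=1..m. (real u)\<^sup>2 * ln (real u / real m))) / (real m)\<^sup>2 + real m * (real m ^ 4 / real n)"
    by (simp add: sum.distrib sum_divide_distrib[symmetric] sum_distrib_left[symmetric]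
        sum_distrib_right[symmetric])
  also have "\<dots> \<le> ((real m ^ 3 / 3 + (real m)\<^sup>2) * ln (real n)
      + 6 * ((real m)\<^sup>2 - real m ^ 3 / 9)) / (real m)\<^sup>2 + real m * (real m ^ 4 / real n)"
  proof -
    have "real m \<le> (real m)\<^sup>2"
      using m by (simp add: power2_eq_square)
    then have "(\<Sum>u=1..m. (real u)\<^sup>2) \<le> real m ^ 3 / 3 + (real m)\<^sup>2"
      unfolding sum_squares_upto by (simp add: field_simps power2_eq_square power3_eq_cube)
    then have "(\<Sum>u=1..m. (real u)\<^sup>2) * ln (real n) \<le> (real m ^ 3 / 3 + (real m)\<^sup>2) * ln (real n)"
      using n by (intro mult_right_mono) auto
    then show ?thesis
      using sum_squares_ln_le[OF m] by (intro add_right_mono divide_right_mono add_mono) auto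
  qed
  also have "\<dots> = real m * ((ln (real n) - 2) / 3 + (ln (real n) + 6) / real m + real m ^ 4 / real n)"
    using m n by (simp add: field_simps power2_eq_square power3_eq_cube)
  finally show ?thesis
    using m by (simp add: divide_le_eq mult.commute)
qed

theorem theorem1:
  shows "\<exists>\<epsilon> :: nat \<Rightarrow> real. \<epsilon> \<longlonglongrightarrow> 0 \<and>
    (\<forall>n\<ge>1. - 1 \<le> \<epsilon> n \<and>
       real (STS n) \<le> ((1 + \<epsilon> n) * (real n / (exp 1)\<^sup>2)) powr ((real n)\<^sup>2 / 6))"
proof -
  \<comment> \<open>Three times the error of \<open>mean_squares_ln_le\<close>, with
    \<open>m\<close> replaced by its lower and upper bounds. Any exponent strictly between 0 and 1/4
    in place of 1/5 would make both terms vanish in the limit.\<close>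
  define \<delta> :: "nat \<Rightarrow> real" where
    "\<delta> n = 3 * (ln (real n) + 6) / real n powr (1/5) + 3 * (real n powr (1/5) + 1) ^ 4 / real n" for n
  have "(\<lambda>n. exp (\<delta> n) - 1) \<longlonglongrightarrow> 0"
    unfolding \<delta>_def by real_asymp
  moreover have "real (STS n) \<le> ((1 + (exp (\<delta> n) - 1)) * (real n / (exp 1)\<^sup>2)) powr ((real n)\<^sup>2 / 6)"
    if n: "n \<ge> 1" for n
  proof (cases "STS n = 0")
    case False
    define m where "m = nat \<lceil>real n powr (1/5)\<rceil>"
    have root: "real n powr (1/5) \<ge> 1"
      using n by (simp add: ge_one_powr_ge_zero)
    have m: "real n powr (1/5) \<le> real m" "real m \<le> real n powr (1/5) + 1"
      using root unfolding m_def by linarith+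
    then have m0: "m > 0"
      using root by linarith
    define h where "h = (\<Sum>u=1..m. (real u / real m)\<^sup>2 * ln (1 + real n * (real u / real m) ^ 6)) / real m"
    have h0: "h \<ge> 0"
      unfolding h_def by (intro divide_nonneg_nonneg sum_nonneg) auto
    have "ln (real (STS n)) \<le> real (n choose 2) * h"
      using ln_card_steiner_triple_systems_le[of "{1..n}" m] m0 by (simp add: STS_def h_def)
    also have "\<dots> \<le> (real n)\<^sup>2 / 2 * h"
    proof (rule mult_right_mono[OF _ h0])
      have "2 * (n choose 2) \<le> n * n"
        unfolding choose_two by (rule order.trans[OF times_div_less_eq_dividend]) simp
      then have "real (2 * (n choose 2)) \<le> real (n * n)"
        by (rule of_nat_mono)
      then show "real (n choose 2) \<le> (real n)\<^sup>2 / 2"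
        by (simp add: power2_eq_square)
    qed
    also have "\<dots> \<le> (real n)\<^sup>2 / 2 * ((ln (real n) - 2 + \<delta> n) / 3)"
    proof (rule mult_left_mono)
      have "h \<le> (ln (real n) - 2) / 3 + (ln (real n) + 6) / real m + real m ^ 4 / real n"
        using mean_squares_ln_le[OF m0, of n] n by (simp add: h_def)
      also have "\<dots> \<le> (ln (real n) - 2) / 3 + (ln (real n) + 6) / real n powr (1/5)
          + (real n powr (1/5) + 1) ^ 4 / real n"
        using m root n by (intro add_mono divide_left_mono divide_right_mono power_mono mult_pos_pos) auto
      also have "\<dots> = (ln (real n) - 2 + \<delta> n) / 3"
        by (simp add: \<delta>_def add_divide_distrib)
      finally show "h \<le> (ln (real n) - 2 + \<delta> n) / 3" .
    qed simp
    \<comment> \<open>The constant \<open>- 2\<close> turns into the factor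
      \<open>1 / (exp 1)\<^sup>2\<close>, and \<open>\<delta> n\<close> into
      \<open>1 + \<epsilon> n\<close>.\<close>
    also have "\<dots> = (real n)\<^sup>2 / 6 * ln (exp (\<delta> n) * (real n / (exp 1)\<^sup>2))"
      using n by (simp add: ln_mult ln_div ln_realpow)
    finally have "exp (ln (real (STS n))) \<le> exp ((real n)\<^sup>2 / 6 * ln (exp (\<delta> n) * (real n / (exp 1)\<^sup>2)))"
      by simp
    then show ?thesis
      using False n by (simp add: powr_def)
  qed simp
  ultimately show ?thesis
    by (intro exI[of _ "\<lambda>n. exp (\<delta> n) - 1"]) auto
qed

end
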